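(* Let $K_1,\dots,K_n$ be convex bodies in $\mathbb{R}^n$ of class $C^2_+$ with centroid at the origin. Let $p\in[-\infty,\infty]$ with $p\ne -n$, and let $1\le m\le n$ be an integer. Then $$as_p(K_1,\dots,K_n)^m\le\prod_{i=0}^{m-1}as_p(K_1,\dots,K_{n-m},\underbrace{K_{n-i},\dots,K_{n-i}}_{m}).$$ Equality holds if the bodies $K_k$, $k=n-m+1,\dots,n$, are dilates of each other. If $m=1$, equality holds trivially. In particular, for $m=n$, $$as_p(K_1,\dots,K_n)^n\le as_p(K_1)\cdots as_p(K_n).$$
   Context: $K\in C^2_+$ means that $\partial K$ is of class $C^2$ with everywhere strictly positive Gauss curvature. $h_K$ is the support function of $K$; $f_K(u)$, $u\in S^{n-1}$, is the curvature function, i.e. the reciprocal of the Gauss curvature of $\partial K$ at the unique boundary point with outer unit normal $u$. $\sigma$ is the surface area measure on $S^{n-1}$. For real $p\neq-n$ the mixed $p$-affine surface area is $$as_p(K_1,\dots,K_n)=\int_{S^{n-1}}\big[h_{K_1}(u)^{1-p}f_{K_1}(u)\cdots h_{K_n}(u)^{1-p}f_{K_n}(u)\big]^{\frac1{n+p}}\,d\sigma(u),$$ and for $p=\pm\infty$, $as_{\pm\infty}(K_1,\dots,K_n)=\int_{S^{n-1}}\frac{1}{h_{K_1}(u)\cdots h_{K_n}(u)}\,d\sigma(u)$. Also $as_p(K)=as_p(K,\dots,K)$. Two bodies $K,L$ with centroid at the origin are dilates of each other if $K=\lambda L$ for some $\lambda>0$. *)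

theory Defs
  imports "HOL-Analysis.Analysis"
begin

section \<open>Convex bodies\<close>

definition convex_body :: "'a::euclidean_space set \<Rightarrow> bool" where
  "convex_body K \<longleftrightarrow> convex K \<and> compact K \<and> interior K \<noteq> {}"

definition centroid :: "'a::euclidean_space set \<Rightarrow> 'a" where
  "centroid K = (1 / measure lebesgue K) *\<^sub>R (LINT x:K|lebesgue. x)"

definition dilates :: "'a::real_vector set \<Rightarrow> 'a set \<Rightarrow> bool" where
  "dilates K L \<longleftrightarrow> (\<exists>c>0. K = (\<lambda>x. c *\<^sub>R x) ` L)"

definition support_function :: "'a::real_inner set \<Rightarrow> 'a \<Rightarrow> real" where
  "support_function K u = (SUP x\<in>K. x \<bullet> u)"

section \<open>Hypersurfaces of class \<open>C\<^sup>2\<close> and Gauss curvature\<close>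

text \<open>On \<open>U\<close>, \<open>g\<close> is twice continuously differentiable with gradient \<open>G\<close>.\<close>

definition C2_on :: "(real^'n \<Rightarrow> real) \<Rightarrow> (real^'n \<Rightarrow> real^'n) \<Rightarrow> (real^'n) set \<Rightarrow> bool" where
  "C2_on g G U \<longleftrightarrow>
     (\<exists>H :: real^'n \<Rightarrow> real^'n^'n.
        (\<forall>x\<in>U. (g has_derivative (\<lambda>v. G x \<bullet> v)) (at x)) \<and>
        (\<forall>x\<in>U. (G has_derivative (\<lambda>v. H x *v v)) (at x)) \<and>
        continuous_on U H)"

text \<open>The boundary is locally the zero set of a \<open>C\<^sup>2\<close> function with non-vanishing gradient,
  i.e. it is an embedded hypersurface of class \<open>C\<^sup>2\<close>.\<close>

definition C2_boundary :: "(real^'n) set \<Rightarrow> bool" where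
  "C2_boundary K \<longleftrightarrow>
     (\<forall>x\<in>frontier K. \<exists>U g G. open U \<and> x \<in> U \<and> C2_on g G U \<and> (\<forall>y\<in>U. G y \<noteq> 0) \<and>
        frontier K \<inter> U = {y\<in>U. g y = 0})"

definition outer_unit_normal :: "'a::real_inner set \<Rightarrow> 'a \<Rightarrow> 'a \<Rightarrow> bool" where
  "outer_unit_normal K x u \<longleftrightarrow> norm u = 1 \<and> (\<forall>y\<in>K. (y - x) \<bullet> u \<le> 0)"

definition gauss_map :: "'a::real_inner set \<Rightarrow> 'a \<Rightarrow> 'a" where
  "gauss_map K x = (THE u. outer_unit_normal K x u)"

text \<open>The Gauss curvature is the determinant of the Weingarten map, the differential of the
  Gauss map \<open>\<nu>\<close> on the tangent space \<open>\<nu>\<^sup>\<bottom>\<close>.  To take the determinant of an endomorphism of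
  the whole space, the Weingarten map is extended by the identity on the normal line, which does
  not change its determinant.  The derivative \<open>D\<close> within the boundary is determined only on
  tangent vectors, but its values elsewhere do not enter.\<close>

definition gauss_curvature :: "(real^'n) set \<Rightarrow> real^'n \<Rightarrow> real" where
  "gauss_curvature K x =
     (let \<nu> = gauss_map K x in
      THE k. \<exists>D. (gauss_map K has_derivative D) (at x within frontier K) \<and>
        k = det (matrix (\<lambda>v. D (v - (v \<bullet> \<nu>) *\<^sub>R \<nu>) + (v \<bullet> \<nu>) *\<^sub>R \<nu>)))"

definition C2_plus :: "(real^'n) set \<Rightarrow> bool" where
  "C2_plus K \<longleftrightarrow> C2_boundary K \<and> (\<forall>x\<in>frontier K. gauss_curvature K x > 0)"

definition curvature_function :: "(real^'n) set \<Rightarrow> real^'n \<Rightarrow> real" where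
  "curvature_function K u =
     1 / gauss_curvature K (THE x. x \<in> frontier K \<and> outer_unit_normal K x u)"

section \<open>Mixed affine surface areas\<close>

text \<open>The surface area measure on the unit sphere: \<open>\<sigma>(A)\<close> is the dimension times the volume of
  the cone \<open>{r u | 0 < r < 1, u \<in> A}\<close>; recall that \<open>sgn x = x / norm x\<close>.\<close>

definition sphere_measure :: "'a::euclidean_space measure" where
  "sphere_measure =
     scale_measure (of_nat DIM('a))
       (distr (restrict_space lborel (ball 0 1 - {0})) (restrict_space borel (sphere 0 1)) sgn)"

lemma sgn_measurable_sphere [measurable]:
  "sgn \<in> measurable (restrict_space lborel (ball 0 1 - {0}))
     (restrict_space borel (sphere (0::'a::euclidean_space) 1))"
  by (rule measurable_restrict_space3) (auto simp: norm_sgn)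

lemma space_sphere_measure [simp]: "space sphere_measure = sphere 0 1"
  and sets_sphere_measure [measurable_cong, simp]:
    "sets sphere_measure = sets (restrict_space borel (sphere 0 1))"
  by (simp_all add: sphere_measure_def space_scale_measure space_restrict_space)

lemma emeasure_sphere_measure:
  fixes A :: "'a::euclidean_space set"
  assumes "A \<in> sets (restrict_space borel (sphere 0 1))"
  shows "emeasure sphere_measure A =
    of_nat DIM('a) * emeasure lborel {x \<in> ball 0 1 - {0}. sgn x \<in> A}"
proof -
  have eq: "sgn -` A \<inter> space (restrict_space lborel (ball 0 1 - {0})) =
      {x \<in> ball 0 1 - {0}. sgn x \<in> A}"
    by (auto simp: space_restrict_space)
  have "emeasure (restrict_space lborel (ball 0 1 - {0})) {x \<in> ball 0 1 - {0::'a}. sgn x \<in> A} =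
      emeasure lborel {x \<in> ball 0 1 - {0}. sgn x \<in> A}"
    by (rule emeasure_restrict_space) auto
  then show ?thesis
    unfolding sphere_measure_def emeasure_scale_measure
      emeasure_distr[OF sgn_measurable_sphere assms] eq by simp
qed

text \<open>The bodies are \<open>K 1, \<dots>, K n\<close> with \<open>n = CARD('n)\<close>; other values of \<open>K\<close> are irrelevant.\<close>

definition mixed_affine_surface_area :: "ereal \<Rightarrow> (nat \<Rightarrow> (real^'n) set) \<Rightarrow> real" where
  "mixed_affine_surface_area p K =
     (case p of
        ereal q \<Rightarrow>
          (LINT u|sphere_measure.
             (\<Prod>k=1..CARD('n). support_function (K k) u powr (1 - q) * curvature_function (K k) u)
               powr (1 / (real CARD('n) + q)))
      | _ \<Rightarrow> (LINT u|sphere_measure. 1 / (\<Prod>k=1..CARD('n). support_function (K k) u)))"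

definition affine_surface_area :: "ereal \<Rightarrow> (real^'n) set \<Rightarrow> real" where
  "affine_surface_area p K = mixed_affine_surface_area p (\<lambda>_. K)"

end

theory Submission
  imports Defs
begin

text \<open>The integrand of the mixed area is a product of one density per body, so the inequality is
  Hoelder's inequality for the densities of the last \<open>m\<close> bodies with the product of the remaining
  ones as weight; dilates have proportional densities, which gives equality.  The integrals must be
  finite, which amounts to the densities being continuous and positive on the sphere.  Near a
  boundary point the Gauss map is the normalised gradient of a defining function, hence \<open>C\<^sup>1\<close>, so the
  curvature is continuous on the boundary; positive curvature makes the Gauss map injective, and by
  compactness its inverse is continuous.  The support function is positive because a centroid is
  an interior point.\<close>

section \<open>Tangent vectors\<close>

text \<open>\<open>gauss_curvature\<close> rests on a derivative within the frontier, a set without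
  interior, so this derivative is not unique as a linear map and the \<open>THE\<close> in the
  definition has to be justified. \<open>tangent_vector\<close> is membership in the contingent
  (Bouligand) cone. Derivatives within a set agree on its cone, whatever the shape of the set; this
  covers both the frontier and the level sets of the Gauss map in the injectivity argument. For the
  frontier the cone contains every vector orthogonal to the gradient of a defining function, which
  forces outer normals to be parallel to that gradient and makes the curvature well defined. A
  defining function does not reveal on which side of the hypersurface \<open>K\<close> lies. The
  orientation is recovered from the origin: as an interior point it gives
  \<open>x \<bullet> u > 0\<close> for every outer normal \<open>u\<close> at
  \<open>x\<close>.\<close>

definition tangent_vector :: "'a::real_normed_vector set \<Rightarrow> 'a \<Rightarrow> 'a \<Rightarrow> bool" where
  "tangent_vector S y v \<longleftrightarrow> (\<exists>t z. (\<forall>k. 0 < t k) \<and> t \<longlonglongrightarrow> 0 \<and> (\<forall>k::nat. z k \<in> S) \<and>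
    (\<lambda>k. (1 / t k) *\<^sub>R (z k - y)) \<longlonglongrightarrow> v)"

lemma tangent_vectorI:
  fixes z :: "nat \<Rightarrow> 'a::real_normed_vector"
  assumes "\<And>k. 0 < t k" "t \<longlonglongrightarrow> 0" "\<And>k. z k \<in> S" "(\<lambda>k. (1 / t k) *\<^sub>R (z k - y)) \<longlonglongrightarrow> v"
  shows "tangent_vector S y v"
  using assms unfolding tangent_vector_def by blast

lemma tangent_vectorE:
  assumes "tangent_vector S y v"
  obtains t z where "\<And>k. 0 < t k" "t \<longlonglongrightarrow> 0" "\<And>k::nat. z k \<in> S"
    "(\<lambda>k. (1 / t k) *\<^sub>R (z k - y)) \<longlonglongrightarrow> v"
  using assms unfolding tangent_vector_def by blast

lemma tangent_vector_mono: "tangent_vector S y v \<Longrightarrow> S \<subseteq> T \<Longrightarrow> tangent_vector T y v"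
  unfolding tangent_vector_def by blast

lemma tangent_vector_segment:
  assumes "\<And>t. 0 < t \<Longrightarrow> t \<le> 1 \<Longrightarrow> y + t *\<^sub>R v \<in> S"
  shows "tangent_vector S y v"
proof (rule tangent_vectorI[of "\<lambda>k. 1 / real (Suc k)" "\<lambda>k. y + (1 / real (Suc k)) *\<^sub>R v"])
  show "(\<lambda>k. 1 / real (Suc k)) \<longlonglongrightarrow> 0" using lim_inverse_n' LIMSEQ_Suc by blast
  show "y + (1 / real (Suc k)) *\<^sub>R v \<in> S" for k by (rule assms) auto
qed (simp_all del: of_nat_Suc)

lemma tangent_vector_halfspace:
  assumes "tangent_vector S y v" "\<And>z. z \<in> S \<Longrightarrow> u \<bullet> (z - y) \<le> 0"
  shows "u \<bullet> v \<le> 0"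
  using assms(1)
proof (rule tangent_vectorE)
  fix t z assume t: "\<And>k. 0 < t k" and z: "\<And>k::nat. z k \<in> S"
    and lim: "(\<lambda>k. (1 / t k) *\<^sub>R (z k - y)) \<longlonglongrightarrow> v"
  have "u \<bullet> ((1 / t k) *\<^sub>R (z k - y)) \<le> 0" for k
    using assms(2)[OF z[of k]] t[of k] by (simp add: divide_le_0_iff)
  then show ?thesis
    by (intro LIMSEQ_le_const2[OF tendsto_inner[OF tendsto_const lim]]) auto
qed

text \<open>Takes the place of the implicit function theorem. On the line s -> y + t (v + s a) the
  function \<open>g\<close> equals t s |a|^2 up to a small error, so it changes sign between s = -e'
  and s = e', and the intermediate value theorem yields a zero whose direction from \<open>y\<close>
  is close to \<open>v\<close>.\<close>

lemma level_set_tangent: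
  fixes g :: "'a::real_inner \<Rightarrow> real" and y a v :: 'a
  assumes U: "open U" "y \<in> U" and g: "(g has_derivative (\<lambda>w. a \<bullet> w)) (at y)"
    and cont: "continuous_on U g" and y: "g y = 0" and a: "a \<noteq> 0" "a \<bullet> v = 0"
  shows "tangent_vector {z \<in> U. g z = 0} y v"
proof -
  have step: "\<exists>t z. 0 < t \<and> t < e \<and> z \<in> U \<and> g z = 0 \<and> norm ((1 / t) *\<^sub>R (z - y) - v) < e"
    if "e > 0" for e
  proof -
    \<comment> \<open>\<open>e'\<close> bounds the correction s, which keeps the length of s a below
      \<open>e\<close>. \<open>M\<close> then bounds the length of v + s a, and \<open>c\<close> is
      the accuracy for which the linearisation error at distance t M is half of the main term t e'
      |a|^2.\<close>
    define e' where "e' = e / (2 * norm a)"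
    have e': "e' > 0" using that a by (simp add: e'_def)
    define M where "M = norm v + e' * norm a + 1"
    have M: "M > 0" using e' by (simp add: M_def add_nonneg_pos)
    define c where "c = e' * (norm a)\<^sup>2 / (2 * M)"
    have c: "c > 0" using e' a M by (simp add: c_def)
    obtain d1 where d1: "d1 > 0"
      "\<And>x. norm (x - y) < d1 \<Longrightarrow> norm (g x - g y - a \<bullet> (x - y)) \<le> c * norm (x - y)"
      using g c unfolding has_derivative_at_alt by blast
    obtain d2 where d2: "d2 > 0" "ball y d2 \<subseteq> U"
      using U open_contains_ball by blast
    define t where "t = min (e / 2) (min d1 d2 / (2 * M))"
    have t: "t > 0" "t < e" using that d1 d2 M by (auto simp: t_def)
    have tM: "t * M < min d1 d2"
    proof -
      have "t * M \<le> min d1 d2 / (2 * M) * M"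
        using M by (intro mult_right_mono) (auto simp: t_def)
      then show ?thesis using M d1 d2 by (simp split: if_splits)
    qed
    define q where "q s = y + t *\<^sub>R (v + s *\<^sub>R a)" for s
    have bd: "norm (q s - y) \<le> t * M" if "\<bar>s\<bar> \<le> e'" for s
    proof -
      have "norm (v + s *\<^sub>R a) \<le> norm v + \<bar>s\<bar> * norm a"
        using norm_triangle_ineq[of v "s *\<^sub>R a"] by simp
      also have "\<dots> \<le> M"
        using mult_right_mono[OF that norm_ge_zero[of a]] by (simp add: M_def)
      finally show ?thesis using t by (simp add: q_def)
    qed
    have inU: "q s \<in> U" if "\<bar>s\<bar> \<le> e'" for s
      using bd[OF that] tM d2 by (auto simp: dist_norm norm_minus_commute)
    have near: "\<bar>g (q s) - t * s * (norm a)\<^sup>2\<bar> \<le> t * e' * (norm a)\<^sup>2 / 2" if "\<bar>s\<bar> \<le> e'" for s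
    proof -
      have "norm (g (q s) - g y - a \<bullet> (q s - y)) \<le> c * norm (q s - y)"
        using d1 bd[OF that] tM by simp
      also have "\<dots> \<le> c * (t * M)" using c bd[OF that] by (simp add: mult_left_mono)
      also have "\<dots> = t * e' * (norm a)\<^sup>2 / 2" using M by (simp add: c_def)
      also have "a \<bullet> (q s - y) = t * s * (norm a)\<^sup>2"
        using a by (simp add: q_def inner_add_right power2_norm_eq_inner)
      finally show ?thesis using y by simp
    qed
    have pos: "t * e' * (norm a)\<^sup>2 > 0" using t e' a by simp
    have "\<exists>s. -e' \<le> s \<and> s \<le> e' \<and> g (q s) = 0"
    proof (rule IVT')
      have "\<bar>g (q (-e')) + t * e' * (norm a)\<^sup>2\<bar> \<le> t * e' * (norm a)\<^sup>2 / 2"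
        using near[of "-e'"] e' by simp
      then show "g (q (-e')) \<le> 0" using pos by linarith
      have "\<bar>g (q e') - t * e' * (norm a)\<^sup>2\<bar> \<le> t * e' * (norm a)\<^sup>2 / 2"
        using near[of "e'"] e' by simp
      then show "0 \<le> g (q e')" using pos by linarith
      show "-e' \<le> e'" using e' by simp
      have "continuous_on {-e'..e'} q" unfolding q_def by (intro continuous_intros)
      moreover have "q ` {-e'..e'} \<subseteq> U" using inU by (auto simp: abs_le_iff)
      ultimately show "continuous_on {-e'..e'} (\<lambda>s. g (q s))"
        using continuous_on_compose2[OF cont] by blast
    qed
    then obtain s where s: "\<bar>s\<bar> \<le> e'" "g (q s) = 0" by (metis abs_le_iff minus_le_iff)
    have "norm ((1 / t) *\<^sub>R (q s - y) - v) = \<bar>s\<bar> * norm a" using t by (simp add: q_def)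
    also have "\<dots> \<le> e' * norm a" using s by (simp add: mult_right_mono)
    also have "\<dots> < e" using a that by (simp add: e'_def)
    finally show ?thesis using t s inU by blast
  qed
  have "\<forall>k::nat. \<exists>t z. 0 < t \<and> t < 1 / Suc k \<and> z \<in> U \<and> g z = 0 \<and>
      norm ((1 / t) *\<^sub>R (z - y) - v) < 1 / Suc k"
    using step by simp
  then obtain t z where tz: "\<And>k::nat. 0 < t k \<and> t k < 1 / Suc k \<and> z k \<in> U \<and> g (z k) = 0 \<and>
      norm ((1 / t k) *\<^sub>R (z k - y) - v) < 1 / Suc k"
    by metis
  have lim: "(\<lambda>k. 1 / real (Suc k)) \<longlonglongrightarrow> 0"
    using lim_inverse_n' LIMSEQ_Suc by blast
  have "t \<longlonglongrightarrow> 0"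
    by (rule tendsto_sandwich[OF _ _ tendsto_const lim])
      (use tz in \<open>auto intro!: always_eventually less_imp_le\<close>)
  moreover
  have "(\<lambda>k. (1 / t k) *\<^sub>R (z k - y) - v) \<longlonglongrightarrow> 0"
    by (rule Lim_null_comparison[OF _ lim]) (use tz in \<open>auto intro!: always_eventually less_imp_le\<close>)
  then have "(\<lambda>k. (1 / t k) *\<^sub>R (z k - y)) \<longlonglongrightarrow> v" by (rule LIM_zero_cancel)
  ultimately show ?thesis using tz by (intro tangent_vectorI[of t z]) auto
qed

text \<open>The remainder of the linear approximation is o(|z_k - y|). Divided by t_k it still tends
  to 0, because the quotients (z_k - y) / t_k converge and are therefore bounded by some
  \<open>B\<close>.\<close>

lemma has_derivative_along_tangent:
  fixes f :: "'a::real_normed_vector \<Rightarrow> 'b::real_normed_vector"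
  assumes f: "(f has_derivative D) (at y within S)"
    and t: "\<And>k::nat. 0 < t k" "t \<longlonglongrightarrow> 0" and z: "\<And>k. z k \<in> S"
    and v: "(\<lambda>k. (1 / t k) *\<^sub>R (z k - y)) \<longlonglongrightarrow> v"
  shows "(\<lambda>k. (1 / t k) *\<^sub>R (f (z k) - f y)) \<longlonglongrightarrow> D v"
proof -
  interpret D: bounded_linear D using f has_derivative_bounded_linear by blast
  have zy: "z \<longlonglongrightarrow> y"
  proof -
    have "(\<lambda>k. t k *\<^sub>R ((1 / t k) *\<^sub>R (z k - y))) \<longlonglongrightarrow> 0 *\<^sub>R v" by (intro tendsto_scaleR t v)
    moreover have "t k \<noteq> 0" for k using t(1)[of k] by simp
    ultimately show ?thesis by (simp add: LIM_zero_iff)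
  qed
  obtain B where B: "B > 0" "\<And>k. norm ((1 / t k) *\<^sub>R (z k - y)) \<le> B"
    using convergentI[OF v, THEN convergent_imp_Bseq] by (auto elim: BseqE)
  have "(\<lambda>k. (1 / t k) *\<^sub>R (f (z k) - f y) - D ((1 / t k) *\<^sub>R (z k - y))) \<longlonglongrightarrow> 0"
  proof (rule LIMSEQ_I)
    fix r :: real assume r: "r > 0"
    obtain d where d: "d > 0" "\<And>x. x \<in> S \<Longrightarrow> norm (x - y) < d \<Longrightarrow>
        norm (f x - f y - D (x - y)) \<le> r / (2 * B) * norm (x - y)"
    proof -
      have "r / (2 * B) > 0" using r B by simp
      with f that show thesis unfolding has_derivative_within_alt by blast
    qed
    obtain N where N: "\<And>k. k \<ge> N \<Longrightarrow> norm (z k - y) < d"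
      using LIMSEQ_D[OF zy d(1)] by blast
    have "norm ((1 / t k) *\<^sub>R (f (z k) - f y) - D ((1 / t k) *\<^sub>R (z k - y)) - 0) < r" if "k \<ge> N" for k
    proof -
      have "norm ((1 / t k) *\<^sub>R (f (z k) - f y) - D ((1 / t k) *\<^sub>R (z k - y)) - 0)
          = norm ((1 / t k) *\<^sub>R (f (z k) - f y - D (z k - y)))"
        by (simp only: D.scaleR scaleR_diff_right[of _ "f (z k) - f y"] diff_0_right)
      also have "\<dots> = (1 / t k) * norm (f (z k) - f y - D (z k - y))"
        using t(1)[of k] by simp
      also have "\<dots> \<le> (1 / t k) * (r / (2 * B) * norm (z k - y))"
        using t(1)[of k] d(2)[OF z N[OF that]] by (intro mult_left_mono) auto
      also have "\<dots> = r / (2 * B) * norm ((1 / t k) *\<^sub>R (z k - y))"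
        using t(1)[of k] by simp
      also have "\<dots> \<le> r / (2 * B) * B" using B r by (intro mult_left_mono) auto
      also have "\<dots> < r" using B r by simp
      finally show ?thesis .
    qed
    then show "\<exists>no. \<forall>n\<ge>no. norm ((1 / t n) *\<^sub>R (f (z n) - f y) - D ((1 / t n) *\<^sub>R (z n - y)) - 0) < r"
      by blast
  qed
  from tendsto_add[OF this D.tendsto[OF v]] show ?thesis by simp
qed

lemma has_derivative_tangent_unique:
  fixes f :: "'a::real_normed_vector \<Rightarrow> 'b::real_normed_vector"
  assumes "(f has_derivative D) (at y within S)" "(f has_derivative D') (at y within S)"
    and "tangent_vector S y v"
  shows "D v = D' v"
  using assms(3)
proof (rule tangent_vectorE)
  fix t z assume "\<And>k. 0 < t k" "t \<longlonglongrightarrow> 0" "\<And>k::nat. z k \<in> S"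
    "(\<lambda>k. (1 / t k) *\<^sub>R (z k - y)) \<longlonglongrightarrow> v"
  from has_derivative_along_tangent[OF assms(1) this] has_derivative_along_tangent[OF assms(2) this]
  show ?thesis by (rule LIMSEQ_unique)
qed

section \<open>The Gauss map and the curvature function\<close>

text \<open>The differential of the radial projection onto the unit sphere. The explicit formula is
  kept because \<open>gauss_map_chart\<close> reads off from it that the derivative depends
  continuously on the base point.\<close>

lemma has_derivative_sgn_compose:
  fixes G :: "'a::real_normed_vector \<Rightarrow> 'b::real_inner"
  assumes "(G has_derivative G') (at x within S)" "G x \<noteq> 0"
  shows "((\<lambda>x. sgn (G x)) has_derivative
    (\<lambda>v. (G' v - (sgn (G x) \<bullet> G' v) *\<^sub>R sgn (G x)) /\<^sub>R norm (G x))) (at x within S)"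
proof -
  have n: "((\<lambda>x. norm (G x)) has_derivative (\<lambda>v. sgn (G x) \<bullet> G' v)) (at x within S)"
    using has_derivative_compose[OF assms(1) has_derivative_norm[OF assms(2)]]
    by (simp add: inner_commute)
  have "((\<lambda>x. inverse (norm (G x)) *\<^sub>R G x) has_derivative
    (\<lambda>v. inverse (norm (G x)) *\<^sub>R G' v +
      (- (inverse (norm (G x)) * (sgn (G x) \<bullet> G' v) * inverse (norm (G x)))) *\<^sub>R G x)) (at x within S)"
    using assms by (intro has_derivative_scaleR Deriv.has_derivative_inverse[OF _ n]) auto
  then show ?thesis
    by (simp add: sgn_div_norm scaleR_diff_right divide_inverse mult_ac)
qed

lemma continuous_on_matrix_vector_mult:
  fixes A :: "'a::topological_space \<Rightarrow> real^'n^'m"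
  assumes "continuous_on S A" "continuous_on S v"
  shows "continuous_on S (\<lambda>x. A x *v v x)"
  unfolding matrix_vector_mult_def using assms by (intro continuous_intros)

lemma continuous_on_det:
  fixes A :: "'a::topological_space \<Rightarrow> real^'n^'n"
  assumes "continuous_on S A"
  shows "continuous_on S (\<lambda>x. det (A x))"
  unfolding det_def using assms by (intro continuous_intros)

lemma continuous_on_locally:
  fixes f :: "'a::t2_space \<Rightarrow> 'b::topological_space"
  assumes "\<And>x. x \<in> S \<Longrightarrow> \<exists>U. open U \<and> x \<in> U \<and> continuous_on (S \<inter> U) f"
  shows "continuous_on S f"
  unfolding continuous_on_eq_continuous_within
proof
  fix x assume x: "x \<in> S"
  obtain U where U: "open U" "x \<in> U" "continuous_on (S \<inter> U) f" using assms[OF x] by blast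
  have "at x within S = at x within (S \<inter> U)"
    by (rule at_within_nhd[OF U(2,1)]) auto
  then show "continuous (at x within S) f"
    using U x by (simp add: continuous_on_eq_continuous_within)
qed

lemma has_derivative_cong_locally:
  assumes f: "(f has_derivative f') (at x within S)" and U: "open U" "x \<in> S \<inter> U"
    and eq: "\<And>y. y \<in> S \<inter> U \<Longrightarrow> f y = g y"
  shows "(g has_derivative f') (at x within S)"
proof -
  obtain d where "d > 0" "ball x d \<subseteq> U" using U open_contains_ball by blast
  then show ?thesis
    using eq U(2) by (intro has_derivative_transform_within[OF f]) (auto simp: dist_commute subset_iff)
qed

section \<open>Convex bodies of class C^2 with positive curvature and the origin inside\<close>

locale C2_plus_body =
  fixes K :: "(real^'n) set"
  assumes convex_body: "convex_body K" and C2_plus: "C2_plus K" and zero: "0 \<in> interior K"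
begin

lemma compact: "compact K" and convex: "convex K" and closed: "closed K"
  using convex_body by (auto simp: convex_body_def compact_imp_closed)

lemma frontier_subset: "frontier K \<subseteq> K"
  using closed by (rule frontier_subset_closed)

lemma compact_frontier: "compact (frontier K)"
  using compact by (rule compact_frontier)

text \<open>A ball of radius r around the origin lies in \<open>K\<close>, so the point r u does
  too, and x attains at least the value r in direction u. This orients the normals and later gives
  positivity of the support function.\<close>

lemma outer_normal_inner_pos:
  assumes "outer_unit_normal K x u"
  shows "x \<bullet> u > 0"
proof -
  obtain r where r: "r > 0" "cball 0 r \<subseteq> K" using zero by (auto simp: mem_interior_cball)
  have "r *\<^sub>R u \<in> K" using assms r by (auto simp: outer_unit_normal_def)
  with assms have "r * (u \<bullet> u) \<le> x \<bullet> u"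
    by (auto simp: outer_unit_normal_def inner_diff_left)
  then show ?thesis using assms r by (simp add: outer_unit_normal_def norm_eq_1)
qed

lemma outer_normal_frontier:
  assumes "x \<in> K" "outer_unit_normal K x u"
  shows "x \<in> frontier K"
proof (rule ccontr)
  assume "x \<notin> frontier K"
  with assms closed have "x \<in> interior K" by (simp add: frontier_def)
  then obtain r where r: "r > 0" "cball x r \<subseteq> K" by (auto simp: mem_interior_cball)
  have "x + r *\<^sub>R u \<in> K" using assms r by (auto simp: outer_unit_normal_def dist_norm)
  with assms have "r * (u \<bullet> u) \<le> 0" by (auto simp: outer_unit_normal_def)
  then show False using assms r by (simp add: outer_unit_normal_def norm_eq_1)
qed

section \<open>Existence, uniqueness and regularity of the outer normal\<close>

lemma outer_normal_exists:
  assumes "x \<in> frontier K"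
  shows "\<exists>u. outer_unit_normal K x u"
proof -
  have "rel_interior K = interior K"
    using zero by (intro rel_interior_nonempty_interior) blast
  then have x: "x \<in> K" "x \<notin> rel_interior K"
    using assms frontier_subset by (auto simp: frontier_def)
  obtain a where a: "a \<noteq> 0" "\<And>y. y \<in> closure K \<Longrightarrow> a \<bullet> x \<le> a \<bullet> y"
    by (rule supporting_hyperplane_relative_frontier[OF convex _ x(2)])
      (use x closure_subset in auto)
  have "0 \<le> a \<bullet> (y - x)" if "y \<in> K" for y
    using a(2)[of y] that closure_subset by (auto simp: inner_diff_right)
  \<comment> \<open>The supporting functional \<open>a\<close> attains its minimum over
    \<open>K\<close> at \<open>x\<close>, so it points inward; hence the minus sign.\<close>
  then have "outer_unit_normal K x (- sgn a)"
    using a(1)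
    by (auto simp: outer_unit_normal_def norm_sgn sgn_div_norm inner_commute zero_le_mult_iff)
  then show ?thesis ..
qed

text \<open>An outer normal is nonpositive on tangent vectors, and if v is orthogonal to
  \<open>a\<close> then both v and -v are tangent. So \<open>u\<close> vanishes on the orthogonal
  complement of \<open>a\<close> and is a multiple of it; the sign of the multiple comes from
  \<open>outer_normal_inner_pos\<close>.\<close>

lemma outer_normal_level_set:
  assumes U: "open U" "y \<in> U" and g: "(g has_derivative (\<lambda>w. a \<bullet> w)) (at y)"
    and cont: "continuous_on U g" and a: "a \<noteq> 0"
    and fr: "frontier K \<inter> U = {y \<in> U. g y = 0}" and y: "y \<in> frontier K"
    and u: "outer_unit_normal K y u"
  shows "u = sgn (y \<bullet> a) *\<^sub>R sgn a"
proof -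
  have gy: "g y = 0" using fr y U by auto
  have le: "u \<bullet> v \<le> 0" if v: "a \<bullet> v = 0" for v
  proof (rule tangent_vector_halfspace)
    show "tangent_vector {z \<in> U. g z = 0} y v"
      using level_set_tangent[OF U g cont gy a v] .
    show "u \<bullet> (z - y) \<le> 0" if "z \<in> {z \<in> U. g z = 0}" for z
      using that fr frontier_subset u by (auto simp: outer_unit_normal_def inner_commute)
  qed
  define c where "c = (u \<bullet> a) / (a \<bullet> a)"
  \<comment> \<open>The component of \<open>u\<close> orthogonal to \<open>a\<close>; the claim is
    that it vanishes.\<close>
  define v where "v = u - c *\<^sub>R a"
  have av: "a \<bullet> v = 0" using a by (simp add: v_def c_def inner_diff_right inner_commute)
  have "u \<bullet> v = 0" using le[of v] le[of "-v"] av by simp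
  then have "v \<bullet> v = 0" using av by (simp add: v_def inner_diff_left)
  then have uc: "u = c *\<^sub>R a" by (simp add: v_def)
  have "norm u = 1" using u by (simp add: outer_unit_normal_def)
  with uc have "\<bar>c\<bar> * norm a = 1" by simp
  then have ca: "\<bar>c\<bar> = inverse (norm a)" using a by (simp add: field_simps)
  have "c * (y \<bullet> a) > 0" using outer_normal_inner_pos[OF u] uc by simp
  then have "sgn c = sgn (y \<bullet> a)" by (auto simp: zero_less_mult_iff)
  with ca have "c = sgn (y \<bullet> a) * inverse (norm a)" by (metis sgn_mult_abs)
  with uc show ?thesis by (simp add: sgn_div_norm)
qed

text \<open>The oriented normalised gradient \<open>N\<close> is differentiable in a full
  neighbourhood in the ambient space, with continuous derivative matrix \<open>M\<close>, and
  restricts to the Gauss map on the frontier. The statement speaks of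
  \<open>outer_unit_normal\<close> because the uniqueness that gives \<open>gauss_map\<close> its
  meaning is obtained from it.\<close>

lemma gauss_map_chart:
  assumes "x \<in> frontier K"
  obtains U N M where "open U" "x \<in> U" "continuous_on U N" "continuous_on U M"
    "\<And>y. y \<in> U \<Longrightarrow> (N has_derivative (\<lambda>v. M y *v v)) (at y)"
    "\<And>y u. y \<in> frontier K \<inter> U \<Longrightarrow> outer_unit_normal K y u \<longleftrightarrow> u = N y"
    "\<And>y v. y \<in> frontier K \<inter> U \<Longrightarrow> v \<bullet> N y = 0 \<Longrightarrow> tangent_vector (frontier K) y v"
proof -
  obtain U0 g G where U0: "open U0" "x \<in> U0" and C2: "C2_on g G U0"
    and G0: "\<And>y. y \<in> U0 \<Longrightarrow> G y \<noteq> 0" and fr: "frontier K \<inter> U0 = {y \<in> U0. g y = 0}"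
    using C2_plus assms unfolding C2_plus_def C2_boundary_def by blast
  obtain H where g: "\<And>y. y \<in> U0 \<Longrightarrow> (g has_derivative (\<lambda>v. G y \<bullet> v)) (at y)"
    and G: "\<And>y. y \<in> U0 \<Longrightarrow> (G has_derivative (\<lambda>v. H y *v v)) (at y)"
    and H: "continuous_on U0 H"
    using C2 unfolding C2_on_def by blast
  have contg: "continuous_on U0 g" and contG: "continuous_on U0 G"
    using g G by (meson continuous_at_imp_continuous_on has_derivative_continuous)+
  have normal: "u = sgn (y \<bullet> G y) *\<^sub>R sgn (G y)"
    if "y \<in> frontier K" "y \<in> U0" "outer_unit_normal K y u" for y u
    using outer_normal_level_set[OF U0(1) _ g contg G0 fr] that by blast
  define s where "s = sgn (x \<bullet> G x)"
  \<comment> \<open>Otherwise the formula in \<open>normal\<close> would make the unit normal at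
    \<open>x\<close> equal to 0.\<close>
  have "x \<bullet> G x \<noteq> 0"
    using outer_normal_exists[OF assms] normal[OF assms U0(2)]
    by (force simp: outer_unit_normal_def)
  then have s: "s * (x \<bullet> G x) > 0" "s \<noteq> 0" "\<bar>s\<bar> = 1" by (auto simp: s_def sgn_if)
  \<comment> \<open>The sign of \<open>y \<bullet> G y\<close> could change inside
    \<open>U0\<close>. On this smaller neighbourhood it is the constant \<open>s\<close>, so that
    the factor in front of the gradient needs no differentiation.\<close>
  define U where "U = {y \<in> U0. 0 < s * (y \<bullet> G y)}"
  have UU0: "U \<subseteq> U0" by (auto simp: U_def)
  have "U = U0 \<inter> (\<lambda>y. s * (y \<bullet> G y)) -` {0<..}" by (auto simp: U_def)
  then have U: "open U" "x \<in> U"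
    using U0 s continuous_open_preimage[of U0 "\<lambda>y. s * (y \<bullet> G y)" "{0<..}"] contG
    by (simp_all add: U_def continuous_intros)
  define N where "N y = s *\<^sub>R sgn (G y)" for y
  define D where "D y v = s *\<^sub>R ((H y *v v - (sgn (G y) \<bullet> (H y *v v)) *\<^sub>R sgn (G y)) /\<^sub>R norm (G y))"
    for y v
  have ND: "(N has_derivative D y) (at y)" if "y \<in> U0" for y
    unfolding N_def D_def
    by (intro has_derivative_scaleR_right has_derivative_sgn_compose G G0 that)
  have contN: "continuous_on U0 N"
    unfolding N_def sgn_div_norm using G0 contG by (intro continuous_intros) auto
  have contD: "continuous_on U0 (\<lambda>y. D y v)" for v
    unfolding D_def sgn_div_norm using G0 contG H
    by (intro continuous_intros continuous_on_matrix_vector_mult) auto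
  have contM: "continuous_on U0 (\<lambda>y. matrix (D y))"
    unfolding matrix_def by (intro continuous_intros contD)
  have DM: "D y = (\<lambda>v. matrix (D y) *v v)" if "y \<in> U0" for y
    using ND[OF that] by (simp add: has_derivative_bounded_linear bounded_linear.linear fun_eq_iff)
  have sN: "sgn (y \<bullet> G y) = s" if "y \<in> U" for y
    using that s by (auto simp: U_def zero_less_mult_iff abs_if split: if_splits)
  show thesis
  proof (rule that[OF U])
    show "continuous_on U N" "continuous_on U (\<lambda>y. matrix (D y))"
      using contN contM UU0 continuous_on_subset by blast+
    show "(N has_derivative (\<lambda>v. matrix (D y) *v v)) (at y)" if "y \<in> U" for y
      using ND[of y] DM[of y] that UU0 by auto
    show "outer_unit_normal K y u \<longleftrightarrow> u = N y" if "y \<in> frontier K \<inter> U" for y u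
      using that UU0 normal[of y] outer_normal_exists[of y] sN[of y] unfolding N_def
      by (metis IntD1 IntD2 subsetD)
    show "tangent_vector (frontier K) y v" if y: "y \<in> frontier K \<inter> U" and v: "v \<bullet> N y = 0" for y v
    proof -
      have y0: "y \<in> U0" "g y = 0" using y UU0 fr by auto
      have "G y \<bullet> v = 0" using v s(2) G0[OF y0(1)] by (simp add: N_def sgn_div_norm inner_commute)
      from level_set_tangent[OF U0(1) y0(1) g contg y0(2) G0 this] y0
      show ?thesis using fr by (auto elim: tangent_vector_mono)
    qed
  qed
qed

section \<open>The Gauss map, its derivative within the frontier, and the curvature\<close>

lemma outer_unit_normal_iff:
  assumes "x \<in> frontier K"
  shows "outer_unit_normal K x u \<longleftrightarrow> u = gauss_map K x"
proof -
  obtain n where "\<And>u. outer_unit_normal K x u \<longleftrightarrow> u = n"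
    by (rule gauss_map_chart[OF assms]) (use assms in blast)
  then show ?thesis by (simp add: gauss_map_def)
qed

lemma gauss_map_tangent:
  assumes x: "x \<in> frontier K" and v: "v \<bullet> gauss_map K x = 0"
  shows "tangent_vector (frontier K) x v"
proof (rule gauss_map_chart[OF x])
  fix U N assume U: "x \<in> U" 
    and N: "\<And>y u. y \<in> frontier K \<inter> U \<Longrightarrow> outer_unit_normal K y u \<longleftrightarrow> u = N y"
    and tan: "\<And>y v. y \<in> frontier K \<inter> U \<Longrightarrow> v \<bullet> N y = 0 \<Longrightarrow> tangent_vector (frontier K) y v"
  have "N x = gauss_map K x" using N[of x] U x outer_unit_normal_iff[OF x] by simp
  then show ?thesis using tan[of x v] U x v by simp
qed

lemma norm_gauss_map: "x \<in> frontier K \<Longrightarrow> norm (gauss_map K x) = 1"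
  using outer_unit_normal_iff[of x "gauss_map K x"] by (simp add: outer_unit_normal_def)

lemma gauss_map_differentiable:
  assumes "x \<in> frontier K"
  obtains D where "(gauss_map K has_derivative D) (at x within frontier K)"
proof (rule gauss_map_chart[OF assms])
  fix U N M assume U: "open U" "x \<in> U"
    and N: "\<And>y. y \<in> U \<Longrightarrow> (N has_derivative (\<lambda>v. M y *v v)) (at y)"
    and normal: "\<And>y u. y \<in> frontier K \<inter> U \<Longrightarrow> outer_unit_normal K y u \<longleftrightarrow> u = N y"
  have "N y = gauss_map K y" if "y \<in> frontier K \<inter> U" for y
    using normal[OF that] outer_unit_normal_iff that by simp
  then have "(gauss_map K has_derivative (\<lambda>v. M x *v v)) (at x within frontier K)"
    using has_derivative_cong_locally[OF has_derivative_at_withinI[OF N[OF U(2)]] U(1)]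
      assms U by blast
  then show thesis by (rule that)
qed

text \<open>The formula applies the derivative only to projections orthogonal to the normal. These
  are tangent vectors, on which all derivatives within the frontier agree, so every admissible
  choice gives the same determinant.\<close>

lemma gauss_curvature_eq:
  assumes x: "x \<in> frontier K" and D: "(gauss_map K has_derivative D) (at x within frontier K)"
  shows "gauss_curvature K x = det (matrix (\<lambda>v.
    D (v - (v \<bullet> gauss_map K x) *\<^sub>R gauss_map K x) + (v \<bullet> gauss_map K x) *\<^sub>R gauss_map K x))"
  unfolding gauss_curvature_def Let_def
proof (rule the_equality)
  fix k assume "\<exists>D. (gauss_map K has_derivative D) (at x within frontier K) \<and> k = det (matrix (\<lambda>v.
    D (v - (v \<bullet> gauss_map K x) *\<^sub>R gauss_map K x) + (v \<bullet> gauss_map K x) *\<^sub>R gauss_map K x))"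
  then obtain D' where D': "(gauss_map K has_derivative D') (at x within frontier K)"
    and k: "k = det (matrix (\<lambda>v.
      D' (v - (v \<bullet> gauss_map K x) *\<^sub>R gauss_map K x) + (v \<bullet> gauss_map K x) *\<^sub>R gauss_map K x))"
    by blast
  have "D' (v - (v \<bullet> gauss_map K x) *\<^sub>R gauss_map K x) = D (v - (v \<bullet> gauss_map K x) *\<^sub>R gauss_map K x)" for v
    using norm_gauss_map[OF x]
    by (intro has_derivative_tangent_unique[OF D' D] gauss_map_tangent x)
      (simp add: inner_diff_left norm_eq_1)
  then show "k = det (matrix (\<lambda>v.
    D (v - (v \<bullet> gauss_map K x) *\<^sub>R gauss_map K x) + (v \<bullet> gauss_map K x) *\<^sub>R gauss_map K x))"
    using k by simp
qed (use D in blast)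

lemma continuous_on_gauss_map: "continuous_on (frontier K) (gauss_map K)"
  unfolding continuous_on_eq_continuous_within
  by (metis gauss_map_differentiable has_derivative_continuous)

text \<open>In a chart, \<open>M y\<close> serves as derivative within the frontier at every
  frontier point y, so the curvature is a polynomial in the entries of the continuous functions
  \<open>M\<close> and \<open>N\<close>.\<close>

lemma continuous_on_gauss_curvature: "continuous_on (frontier K) (gauss_curvature K)"
proof (rule continuous_on_locally)
  fix x assume x: "x \<in> frontier K"
  show "\<exists>U. open U \<and> x \<in> U \<and> continuous_on (frontier K \<inter> U) (gauss_curvature K)"
  proof (rule gauss_map_chart[OF x])
    fix U N M assume U: "open U" "x \<in> U" and contN: "continuous_on U N" and contM: "continuous_on U M"
      and N: "\<And>y. y \<in> U \<Longrightarrow> (N has_derivative (\<lambda>v. M y *v v)) (at y)"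
      and normal: "\<And>y u. y \<in> frontier K \<inter> U \<Longrightarrow> outer_unit_normal K y u \<longleftrightarrow> u = N y"
    have NK: "N y = gauss_map K y" if "y \<in> frontier K \<inter> U" for y
      using normal[OF that] outer_unit_normal_iff that by simp
    have curv: "gauss_curvature K y =
        det (matrix (\<lambda>v. M y *v (v - (v \<bullet> N y) *\<^sub>R N y) + (v \<bullet> N y) *\<^sub>R N y))"
      if y: "y \<in> frontier K \<inter> U" for y
    proof -
      have yU: "y \<in> U" using y by simp
      have "(gauss_map K has_derivative (\<lambda>v. M y *v v)) (at y within frontier K)"
        using has_derivative_cong_locally[OF has_derivative_at_withinI[OF N[OF yU]] U(1) y NK] .
      from gauss_curvature_eq[OF _ this] show ?thesis using y NK by simp
    qed
    have "continuous_on (frontier K \<inter> U)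
        (\<lambda>y. det (matrix (\<lambda>v. M y *v (v - (v \<bullet> N y) *\<^sub>R N y) + (v \<bullet> N y) *\<^sub>R N y)))"
      unfolding matrix_def
      by (intro continuous_on_det continuous_intros continuous_on_matrix_vector_mult
          continuous_on_subset[OF contN] continuous_on_subset[OF contM]) auto
    then have "continuous_on (frontier K \<inter> U) (gauss_curvature K)"
      by (rule continuous_on_eq) (simp only: curv)
    with U show ?thesis by blast
  qed
qed

text \<open>If two boundary points shared a normal, the Gauss map would be constant on the segment
  between them, so its differential would be singular there.\<close>

lemma inj_on_gauss_map: "inj_on (gauss_map K) (frontier K)"
proof (rule inj_onI, rule ccontr)
  fix x y assume x: "x \<in> frontier K" and y: "y \<in> frontier K"
    and eq: "gauss_map K x = gauss_map K y" and ne: "x \<noteq> y"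
  define u where "u = gauss_map K x"
  define v where "v = y - x"
  have ux: "outer_unit_normal K x u" and uy: "outer_unit_normal K y u"
    using x y eq by (simp_all add: outer_unit_normal_iff u_def)
  have "v \<bullet> u = 0"
    using ux uy x y frontier_subset
    by (force simp: outer_unit_normal_def v_def inner_diff_left)
  \<comment> \<open>The whole segment from \<open>x\<close> to \<open>y\<close> lies in
    \<open>S\<close>, so \<open>v\<close> is tangent to \<open>S\<close>. Within \<open>S\<close>
    the Gauss map has both \<open>D\<close> and the zero map as derivatives, and comparing them on
    \<open>v\<close> gives \<open>D v = 0\<close>.\<close>
  define S where "S = {z \<in> frontier K. gauss_map K z = u}"
  have "tangent_vector S x v"
  proof (rule tangent_vector_segment)
    fix t :: real assume t: "0 < t" "t \<le> 1"
    have "(1 - t) *\<^sub>R x + t *\<^sub>R y \<in> K"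
      using convex x y frontier_subset t by (intro convexD) auto
    then have inK: "x + t *\<^sub>R v \<in> K" by (simp add: v_def algebra_simps)
    have "outer_unit_normal K (x + t *\<^sub>R v) u"
      using ux \<open>v \<bullet> u = 0\<close> by (auto simp: outer_unit_normal_def algebra_simps inner_diff_left inner_add_left)
    then show "x + t *\<^sub>R v \<in> S"
      unfolding S_def using outer_normal_frontier[OF inK] outer_unit_normal_iff
      by (metis (mono_tags, lifting) mem_Collect_eq)
  qed
  obtain D where D: "(gauss_map K has_derivative D) (at x within frontier K)"
    using gauss_map_differentiable[OF x] .
  have "((\<lambda>_. u) has_derivative (\<lambda>_. 0)) (at x within S)" by simp
  then have D0: "(gauss_map K has_derivative (\<lambda>_. 0)) (at x within S)"
    by (rule has_derivative_transform_within[where d = 1]) (use x in \<open>auto simp: S_def u_def\<close>)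
  have "(gauss_map K has_derivative D) (at x within S)"
    by (rule has_derivative_subset[OF D]) (auto simp: S_def)
  from has_derivative_tangent_unique[OF this D0 \<open>tangent_vector S x v\<close>]
  have "D v = 0" .
  define h where "h w = D (w - (w \<bullet> u) *\<^sub>R u) + (w \<bullet> u) *\<^sub>R u" for w
  interpret D: bounded_linear D using D has_derivative_bounded_linear by blast
  have "linear h"
    unfolding h_def
    by (rule linearI)
      (simp_all add: D.add D.diff D.scaleR algebra_simps inner_add_left)
  moreover have "h v = 0" "v \<noteq> 0" using \<open>D v = 0\<close> \<open>v \<bullet> u = 0\<close> ne by (simp_all add: h_def v_def)
  ultimately have "det (matrix h) = 0"
    using det_nz_iff_inj[of h] linear_injective_0[of h] by blast
  then have "gauss_curvature K x = 0"
    using gauss_curvature_eq[OF x D] by (simp add: h_def[abs_def] u_def)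
  then show False using C2_plus x by (auto simp: C2_plus_def)
qed

section \<open>The inverse of the Gauss map\<close>

lemma gauss_map_image: "gauss_map K ` frontier K = sphere 0 1"
proof
  show "gauss_map K ` frontier K \<subseteq> sphere 0 1" using norm_gauss_map by auto
  show "sphere 0 1 \<subseteq> gauss_map K ` frontier K"
  proof
    fix u :: "real^'n" assume u: "u \<in> sphere 0 1"
    have "K \<noteq> {}" using zero interior_subset by blast
    moreover have "continuous_on K (\<lambda>y. y \<bullet> u)" by (intro continuous_intros)
    \<comment> \<open>A maximiser of the linear functional given by u is a boundary point with outer
      normal u.\<close>
    ultimately obtain x where "x \<in> K" "\<forall>y\<in>K. y \<bullet> u \<le> x \<bullet> u"
      using continuous_attains_sup[OF compact] by blast
    then have "x \<in> K" "outer_unit_normal K x u"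
      using u by (auto simp: outer_unit_normal_def inner_diff_left)
    then show "u \<in> gauss_map K ` frontier K"
      using outer_normal_frontier outer_unit_normal_iff by blast
  qed
qed

text \<open>The inverse Gauss map. Its body repeats the \<open>THE\<close> inside
  \<open>curvature_function\<close>, so that \<open>curvature_function_eq\<close> holds by
  unfolding.\<close>

definition boundary_point :: "real^'n \<Rightarrow> real^'n" where
  "boundary_point u = (THE x. x \<in> frontier K \<and> outer_unit_normal K x u)"

lemma boundary_point_eqI:
  assumes "x \<in> K" "outer_unit_normal K x u"
  shows "boundary_point u = x"
  unfolding boundary_point_def
proof (rule the_equality)
  show x: "x \<in> frontier K \<and> outer_unit_normal K x u"
    using assms outer_normal_frontier by blast
  show "y = x" if "y \<in> frontier K \<and> outer_unit_normal K y u" for y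
    using that x outer_unit_normal_iff inj_onD[OF inj_on_gauss_map, of y x] by metis
qed

lemma boundary_point:
  assumes "u \<in> sphere 0 1"
  shows "boundary_point u \<in> frontier K" "outer_unit_normal K (boundary_point u) u"
proof -
  obtain x where "x \<in> frontier K" "u = gauss_map K x"
    using assms gauss_map_image by blast
  then have "x \<in> frontier K" "outer_unit_normal K x u" by (simp_all add: outer_unit_normal_iff)
  moreover from this have "boundary_point u = x"
    using frontier_subset by (intro boundary_point_eqI) auto
  ultimately show "boundary_point u \<in> frontier K" "outer_unit_normal K (boundary_point u) u" by auto
qed

lemma continuous_on_boundary_point: "continuous_on (sphere 0 1) boundary_point"
proof -
  have "boundary_point (gauss_map K x) = x" if "x \<in> frontier K" for x
    using that frontier_subset by (intro boundary_point_eqI) (auto simp: outer_unit_normal_iff)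
  then show ?thesis
    using continuous_on_inv[OF continuous_on_gauss_map compact_frontier, of boundary_point]
    by (simp add: gauss_map_image)
qed

section \<open>Support function and curvature function on the sphere\<close>

lemma support_function_eq:
  assumes "u \<in> sphere 0 1"
  shows "support_function K u = boundary_point u \<bullet> u"
  unfolding support_function_def
proof (rule cSup_eq_maximum)
  show "boundary_point u \<bullet> u \<in> (\<lambda>x. x \<bullet> u) ` K"
    using boundary_point(1)[OF assms] frontier_subset by blast
  show "y \<le> boundary_point u \<bullet> u" if "y \<in> (\<lambda>x. x \<bullet> u) ` K" for y
    using that boundary_point(2)[OF assms] by (auto simp: outer_unit_normal_def inner_diff_left)
qed

lemma support_function_pos: "u \<in> sphere 0 1 \<Longrightarrow> support_function K u > 0"
  by (metis support_function_eq boundary_point(2) outer_normal_inner_pos)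

lemma continuous_on_support_function: "continuous_on (sphere 0 1) (support_function K)"
proof -
  have "continuous_on (sphere 0 1) (\<lambda>u. boundary_point u \<bullet> u)"
    by (intro continuous_intros continuous_on_boundary_point)
  then show ?thesis by (rule continuous_on_eq) (simp only: support_function_eq)
qed

lemma curvature_function_eq: "curvature_function K u = 1 / gauss_curvature K (boundary_point u)"
  by (simp add: curvature_function_def boundary_point_def)

lemma gauss_curvature_pos: "x \<in> frontier K \<Longrightarrow> gauss_curvature K x > 0"
  using C2_plus by (simp add: C2_plus_def)

lemma curvature_function_pos: "u \<in> sphere 0 1 \<Longrightarrow> curvature_function K u > 0"
  by (simp add: curvature_function_eq gauss_curvature_pos boundary_point)

lemma continuous_on_curvature_function: "continuous_on (sphere 0 1) (curvature_function K)"
  unfolding curvature_function_eq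
proof (intro continuous_intros)
  show "continuous_on (sphere 0 1) (\<lambda>u. gauss_curvature K (boundary_point u))"
    by (rule continuous_on_compose2[OF continuous_on_gauss_curvature continuous_on_boundary_point])
      (auto simp: boundary_point)
  show "\<forall>u\<in>sphere 0 1. gauss_curvature K (boundary_point u) \<noteq> 0"
    using gauss_curvature_pos boundary_point(1) by force
qed

end

section \<open>Dilations\<close>

text \<open>An orthogonal map taking \<open>n\<close> to \<open>n'\<close> conjugates one stretch
  into the other. Hence the factor by which a dilation changes the curvature is the same at all
  boundary points, without its value being computed.\<close>

lemma det_axial_stretch_cong:
  fixes n n' :: "real^'n"
  assumes "norm n = 1" "norm n' = 1"
  shows "det (matrix (\<lambda>v. a *\<^sub>R (v - (v \<bullet> n) *\<^sub>R n) + (v \<bullet> n) *\<^sub>R n)) =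
    det (matrix (\<lambda>v. a *\<^sub>R (v - (v \<bullet> n') *\<^sub>R n') + (v \<bullet> n') *\<^sub>R n'))"
proof -
  define h where "h m v = a *\<^sub>R (v - (v \<bullet> m) *\<^sub>R m) + (v \<bullet> m) *\<^sub>R m" for m v :: "real^'n"
  have lin: "linear (h m)" for m
    unfolding h_def by (rule linearI) (simp_all add: algebra_simps inner_add_left)
  obtain f where f: "orthogonal_transformation f" "f n = n'"
    using orthogonal_transformation_exists[of n n'] assms by auto
  have linf: "linear f" using f by (simp add: orthogonal_transformation)
  have "f v \<bullet> n' = v \<bullet> n" for v
    using f by (metis orthogonal_transformation_def)
  then have "h n' \<circ> f = f \<circ> h n"
    using f by (simp add: h_def fun_eq_iff linear_add[OF linf] linear_diff[OF linf] linear_scale[OF linf])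
  then have "det (matrix (h n') ** matrix f) = det (matrix f ** matrix (h n))"
    by (simp flip: matrix_compose[OF linf lin] matrix_compose[OF lin linf])
  moreover have "det (matrix f) \<noteq> 0"
    using f det_orthogonal_matrix by (force simp: orthogonal_transformation_matrix)
  ultimately show ?thesis by (simp add: det_mul h_def[abs_def])
qed

lemma dilation_outer_normal:
  assumes "c > 0" "K = (\<lambda>x. c *\<^sub>R x) ` L"
  shows "outer_unit_normal K (c *\<^sub>R x) u \<longleftrightarrow> outer_unit_normal L x u"
proof -
  have "(c *\<^sub>R y - c *\<^sub>R x) \<bullet> u \<le> 0 \<longleftrightarrow> (y - x) \<bullet> u \<le> 0" for y
    using assms(1) by (simp add: mult_le_0_iff flip: scaleR_diff_right)
  then show ?thesis by (simp add: outer_unit_normal_def assms(2))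
qed

lemma dilation_gauss_map:
  assumes "c > 0" "K = (\<lambda>x. c *\<^sub>R x) ` L"
  shows "gauss_map K (c *\<^sub>R x) = gauss_map L x"
  unfolding gauss_map_def dilation_outer_normal[OF assms] ..

lemma dilation_boundary_point:
  assumes K: "C2_plus_body K" and L: "C2_plus_body L"
    and c: "c > 0" and KL: "K = (\<lambda>x. c *\<^sub>R x) ` L" and u: "u \<in> sphere 0 1"
  shows "C2_plus_body.boundary_point K u = c *\<^sub>R C2_plus_body.boundary_point L u"
  using C2_plus_body.boundary_point[OF L u] C2_plus_body.frontier_subset[OF L] dilation_outer_normal[OF c KL] KL
  by (intro C2_plus_body.boundary_point_eqI[OF K]) auto

lemma dilation_support_function:
  assumes K: "C2_plus_body K" and L: "C2_plus_body L"
    and c: "c > 0" and KL: "K = (\<lambda>x. c *\<^sub>R x) ` L" and u: "u \<in> sphere 0 1"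
  shows "support_function K u = c * support_function L u"
  using dilation_boundary_point[OF assms]
  by (simp add: C2_plus_body.support_function_eq[OF K u] C2_plus_body.support_function_eq[OF L u])

text \<open>\<open>gauss_map K\<close> is \<open>gauss_map L\<close> after scaling by
  \<open>1 / c\<close>. By the chain rule the extended Weingarten map of \<open>K\<close> at
  \<open>c *\<^sub>R x\<close> is that of \<open>L\<close> at \<open>x\<close> composed with
  \<open>h n\<close>, which scales the tangent space by \<open>1 / c\<close> and fixes the normal.
  The curvature is thus multiplied by the determinant of \<open>h n\<close>.\<close>

lemma dilation_curvature_function:
  fixes K L :: "(real^'n) set"
  assumes K: "C2_plus_body K" and L: "C2_plus_body L"
    and c: "c > 0" and KL: "K = (\<lambda>x. c *\<^sub>R x) ` L"
  shows "\<exists>d. \<forall>u\<in>sphere 0 1. curvature_function K u = d * curvature_function L u"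
proof -
  interpret K: C2_plus_body K by (rule K)
  interpret L: C2_plus_body L by (rule L)
  define h where "h n v = (1 / c) *\<^sub>R (v - (v \<bullet> n) *\<^sub>R n) + (v \<bullet> n) *\<^sub>R n" for n v :: "real^'n"
  \<comment> \<open>Any fixed unit vector serves to name the common determinant.\<close>
  obtain e :: "real^'n" where e: "e \<in> sphere 0 1"
    using vector_choose_size[of 1, where 'a = "real^'n"] by (metis zero_le_one mem_sphere_0)
  define d where "d = det (matrix (h e))"
  have scale: "gauss_curvature K (c *\<^sub>R x) = gauss_curvature L x * d" if x: "x \<in> frontier L" for x
  proof -
    define n where "n = gauss_map L x"
    have n1: "norm n = 1" "n \<bullet> n = 1" using L.norm_gauss_map[OF x] by (simp_all add: n_def norm_eq_1)
    have cx: "c *\<^sub>R x \<in> frontier K"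
      using x L.frontier_subset L.outer_unit_normal_iff[OF x] dilation_outer_normal[OF c KL] KL
      by (intro K.outer_normal_frontier) auto
    obtain D where D: "(gauss_map L has_derivative D) (at x within frontier L)"
      using L.gauss_map_differentiable[OF x] .
    interpret D: bounded_linear D using D has_derivative_bounded_linear by blast
    have "(\<lambda>z. (1 / c) *\<^sub>R z) ` frontier K \<subseteq> frontier L"
    proof clarify
      fix z assume z: "z \<in> frontier K"
      then obtain y where y: "y \<in> L" "z = c *\<^sub>R y" using K.frontier_subset KL by blast
      have "outer_unit_normal L y (gauss_map K z)"
        using K.outer_unit_normal_iff[OF z] dilation_outer_normal[OF c KL] y by metis
      then show "(1 / c) *\<^sub>R z \<in> frontier L" using L.outer_normal_frontier y c by simp
    qed
    then have "(gauss_map L has_derivative D) (at ((1 / c) *\<^sub>R (c *\<^sub>R x))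
        within (\<lambda>z. (1 / c) *\<^sub>R z) ` frontier K)"
      using has_derivative_subset[OF D] c by simp
    from has_derivative_in_compose[OF has_derivative_scaleR_right[OF has_derivative_ident] this]
    have "((\<lambda>z. gauss_map L ((1 / c) *\<^sub>R z)) has_derivative (\<lambda>v. D ((1 / c) *\<^sub>R v)))
        (at (c *\<^sub>R x) within frontier K)" .
    moreover have "gauss_map L ((1 / c) *\<^sub>R z) = gauss_map K z" for z
      using dilation_gauss_map[OF c KL, of "(1 / c) *\<^sub>R z"] c by simp
    ultimately have DK: "(gauss_map K has_derivative (\<lambda>v. D ((1 / c) *\<^sub>R v))) (at (c *\<^sub>R x) within frontier K)"
      by simp
    define g where "g v = D (v - (v \<bullet> n) *\<^sub>R n) + (v \<bullet> n) *\<^sub>R n" for v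
    have lin: "linear g" "linear (h n)"
      unfolding g_def h_def
      by (auto intro!: linearI simp: D.add D.diff D.scaleR algebra_simps inner_add_left add_divide_distrib)
    \<comment> \<open>Since \<open>h n\<close> preserves the normal component, projecting
      \<open>h n v\<close> to the tangent space leaves exactly the scaled tangential part of
      v.\<close>
    have "h n v \<bullet> n = v \<bullet> n" for v
      using n1 by (simp add: h_def inner_add_left inner_diff_left)
    then have "D ((1 / c) *\<^sub>R (v - (v \<bullet> n) *\<^sub>R n)) + (v \<bullet> n) *\<^sub>R n = (g \<circ> h n) v" for v
      unfolding g_def o_def by (simp add: h_def)
    then have "gauss_curvature K (c *\<^sub>R x) = det (matrix (g \<circ> h n))"
      using K.gauss_curvature_eq[OF cx DK] dilation_gauss_map[OF c KL, of x] by (simp add: n_def o_def)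
    also have "\<dots> = det (matrix g) * det (matrix (h n))"
      using lin by (simp add: matrix_compose det_mul)
    also have "det (matrix (h n)) = d"
      unfolding d_def h_def using n1 e by (intro det_axial_stretch_cong) auto
    also have "det (matrix g) = gauss_curvature L x"
      using L.gauss_curvature_eq[OF x D] by (simp add: g_def[abs_def] n_def)
    finally show ?thesis .
  qed
  have "curvature_function K u = (1 / d) * curvature_function L u" if u: "u \<in> sphere 0 1" for u
    using scale[OF L.boundary_point(1)[OF u]] dilation_boundary_point[OF K L c KL u]
    by (simp add: K.curvature_function_eq L.curvature_function_eq)
  then show ?thesis by blast
qed

section \<open>Integration on the sphere\<close>

lemma finite_measure_sphere: "finite_measure (sphere_measure :: 'a::euclidean_space measure)"
proof (rule finite_measureI)
  have "emeasure (sphere_measure :: 'a measure) (sphere 0 1) =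
      of_nat DIM('a) * emeasure lborel {x \<in> ball 0 1 - {0::'a}. sgn x \<in> sphere 0 1}"
    by (rule emeasure_sphere_measure) (metis sets.top space_restrict_space space_borel inf_top_right Int_UNIV_right)
  moreover have "emeasure lborel {x \<in> ball 0 1 - {0::'a}. sgn x \<in> sphere 0 1} \<le> emeasure lborel (ball (0::'a) 1)"
    by (rule emeasure_mono) auto
  moreover have "emeasure lborel (ball (0::'a) 1) < \<infinity>"
    by (rule emeasure_bounded_finite) simp
  ultimately show "emeasure sphere_measure (space (sphere_measure :: 'a measure)) \<noteq> \<infinity>"
    by (auto simp: ennreal_mult_eq_top_iff top.extremum_unique)
qed

lemma integrable_sphere_measure:
  fixes f :: "'a::euclidean_space \<Rightarrow> real"
  assumes "continuous_on (sphere 0 1) f"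
  shows "integrable sphere_measure f"
proof -
  interpret finite_measure "sphere_measure :: 'a measure" by (rule finite_measure_sphere)
  obtain B where "\<forall>y\<in>f ` sphere 0 1. norm y \<le> B"
    using compact_imp_bounded[OF compact_continuous_image[OF assms compact_sphere]]
    unfolding bounded_iff by blast
  moreover have "f \<in> borel_measurable sphere_measure"
    using borel_measurable_continuous_on_restrict[OF assms]
    by (simp cong: measurable_cong_sets)
  ultimately show ?thesis by (intro integrable_const_bound[of _ B]) auto
qed

text \<open>With m = \<open>card I\<close>, dividing each \<open>f i\<close> by the m-th root of its
  integral \<open>A i\<close> normalises the factors on the right to 1. The arithmetic-geometric
  mean inequality, applied pointwise and integrated against the weight, then bounds the left
  integral by m terms 1 / m.\<close>

lemma weighted_Holder:
  fixes g :: "'a \<Rightarrow> real" and f :: "'b \<Rightarrow> 'a \<Rightarrow> real"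
  assumes I: "finite I" "I \<noteq> {}"
    and pos: "\<And>x. x \<in> space M \<Longrightarrow> g x \<ge> 0" "\<And>i x. i \<in> I \<Longrightarrow> x \<in> space M \<Longrightarrow> f i x \<ge> 0"
    and int: "integrable M (\<lambda>x. g x * (\<Prod>i\<in>I. f i x))"
      "\<And>i. i \<in> I \<Longrightarrow> integrable M (\<lambda>x. g x * f i x ^ card I)"
  shows "(LINT x|M. g x * (\<Prod>i\<in>I. f i x)) ^ card I \<le> (\<Prod>i\<in>I. LINT x|M. g x * f i x ^ card I)"
proof -
  define A where "A i = (LINT x|M. g x * f i x ^ card I)" for i
  define m where "m = card I"
  have m: "m > 0" using I by (simp add: m_def card_gt_0_iff)
  have A0: "A i \<ge> 0" if "i \<in> I" for i
    unfolding A_def using pos that by (intro Bochner_Integration.integral_nonneg) auto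
  show ?thesis
  proof (cases "\<exists>i\<in>I. A i = 0")
    \<comment> \<open>No normalisation is possible here, but a vanishing \<open>A i\<close> forces
      the weight or \<open>f i\<close> to vanish almost everywhere, and the product with it.\<close>
    case True
    then obtain i where i: "i \<in> I" "A i = 0" by blast
    then have "AE x in M. g x * f i x ^ card I = 0"
      using integral_nonneg_eq_0_iff_AE[OF int(2)[OF i(1)]] pos by (auto simp: A_def)
    then have "AE x in M. g x * (\<Prod>i\<in>I. f i x) = 0"
      by eventually_elim (use I i in auto)
    then have "(LINT x|M. g x * (\<Prod>i\<in>I. f i x)) = 0" by (rule integral_eq_zero_AE)
    then show ?thesis using m A0 by (auto simp: m_def A_def zero_power intro!: prod_nonneg)
  next
    case False
    then have A: "A i > 0" if "i \<in> I" for i using A0[OF that] that by force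
    define r where "r i = root m (A i)" for i
    have r: "r i > 0" "r i ^ m = A i" if "i \<in> I" for i
      using A[OF that] m by (simp_all add: r_def real_root_pow_pos)
    have R: "(\<Prod>i\<in>I. r i) > 0" using r by (simp add: prod_pos)
    have "g x * (\<Prod>i\<in>I. f i x) / (\<Prod>i\<in>I. r i) \<le> (\<Sum>i\<in>I. g x * f i x ^ m / A i / m)"
      if x: "x \<in> space M" for x
    proof -
      define y where "y i = f i x / r i" for i
      have y: "y i \<ge> 0" if "i \<in> I" for i using pos r x that by (simp add: y_def less_imp_le)
      have "(\<Prod>i\<in>I. y i) = (\<Prod>i\<in>I. y i ^ m) powr (1 / m)"
        using m y by (simp add: prod_power_distrib[symmetric] prod_nonneg real_root_power_cancel flip: root_powr_inverse)
      \<comment> \<open>The means are taken of the m-th powers, so that the geometric mean is the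
        plain product of the \<open>y i\<close>.\<close>
      also have "\<dots> \<le> (\<Sum>i\<in>I. y i ^ m / m)"
        unfolding m_def using I y by (intro arith_geom_mean) auto
      finally have "g x * (\<Prod>i\<in>I. y i) \<le> g x * (\<Sum>i\<in>I. y i ^ m / m)"
        using pos x by (intro mult_left_mono) auto
      then show ?thesis
        using r by (simp add: y_def prod_dividef sum_distrib_left power_divide)
    qed
    then have "(LINT x|M. g x * (\<Prod>i\<in>I. f i x) / (\<Prod>i\<in>I. r i)) \<le>
        (LINT x|M. (\<Sum>i\<in>I. g x * f i x ^ m / A i / m))"
      using int by (intro integral_mono) (auto simp: m_def)
    also have "\<dots> = (\<Sum>i\<in>I. A i / A i / m)"
      using int by (subst Bochner_Integration.integral_sum) (auto simp: m_def A_def intro!: sum.cong)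
    also have "\<dots> = (\<Sum>i\<in>I. 1 / m)" using False by (intro sum.cong) auto
    also have "\<dots> = 1" using m by (simp add: m_def)
    finally have "(LINT x|M. g x * (\<Prod>i\<in>I. f i x)) \<le> (\<Prod>i\<in>I. r i)"
      using R by (simp add: divide_le_eq)
    moreover have "0 \<le> (LINT x|M. g x * (\<Prod>i\<in>I. f i x))"
      using pos by (intro Bochner_Integration.integral_nonneg) (auto intro!: mult_nonneg_nonneg prod_nonneg)
    ultimately have "(LINT x|M. g x * (\<Prod>i\<in>I. f i x)) ^ m \<le> (\<Prod>i\<in>I. r i) ^ m"
      by (intro power_mono)
    also have "\<dots> = (\<Prod>i\<in>I. A i)" using r by (simp add: prod_power_distrib)
    finally show ?thesis by (simp add: m_def A_def)
  qed
qed

section \<open>Mixed affine surface areas\<close>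

text \<open>Otherwise \<open>K\<close> lies in a half-space with the origin on its bounding
  hyperplane. The linear functional is nonnegative on \<open>K\<close> with integral 0, so
  \<open>K\<close> is contained in the hyperplane up to a null set and is itself null, against its
  nonempty interior.\<close>

lemma centroid_in_interior:
  fixes K :: "'a::euclidean_space set"
  assumes K: "convex_body K" and c: "centroid K = 0"
  shows "0 \<in> interior K"
proof (rule ccontr)
  assume "0 \<notin> interior K"
  from K have conv: "convex K" and comp: "compact K" and ne: "interior K \<noteq> {}"
    by (auto simp: convex_body_def)
  \<comment> \<open>The origin may belong to \<open>K\<close>, so it is separated from the interior,
    and the inequality passes to \<open>K\<close> by closure.\<close>
  obtain a where a: "a \<noteq> 0" "\<And>x. x \<in> interior K \<Longrightarrow> 0 \<le> a \<bullet> x"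
    using separating_hyperplane_set_0[of "interior K"] \<open>0 \<notin> interior K\<close> convex_interior[OF conv] by blast
  have "closure (interior K) \<subseteq> {x. 0 \<le> a \<bullet> x}"
    using a by (intro closure_minimal closed_halfspace_ge) auto
  then have a_K: "0 \<le> a \<bullet> x" if "x \<in> K" for x
    using that convex_closure_interior[OF conv ne] closure_subset[of K] by blast
  have notneg: "\<not> negligible K"
    using ne open_not_negligible[of "interior K"] negligible_subset[OF _ interior_subset] by blast
  \<comment> \<open>If the volume were 0, division by zero would make \<open>centroid K\<close>
    equal to 0 by convention, and nothing would follow about the integral.\<close>
  then have "measure lebesgue K \<noteq> 0"
    using comp by (simp add: negligible_iff_measure lmeasurable_compact)
  with c have int0: "(LINT x:K|lebesgue. x) = 0" by (simp add: centroid_def)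
  have "integrable lborel (\<lambda>x. indicator K x *\<^sub>R x)"
    by (rule borel_integrable_compact[OF comp continuous_on_id])
  then have int: "integrable lebesgue (\<lambda>x. indicator K x *\<^sub>R x)"
    by (simp add: integrable_completion borel_measurable_integrable)
  have "(LINT x|lebesgue. a \<bullet> (indicator K x *\<^sub>R x)) = 0"
    using int0 integral_inner_right[of a, OF int] by (simp add: set_lebesgue_integral_def)
  then have "AE x in lebesgue. a \<bullet> (indicator K x *\<^sub>R x) = 0"
    using integral_nonneg_eq_0_iff_AE[OF integrable_inner_right[of a, OF int]] a_K
    by (auto simp: indicator_def)
  then have "AE x in lebesgue. x \<in> K \<longrightarrow> a \<bullet> x = 0"
    by eventually_elim auto
  then obtain N where "N \<in> null_sets lebesgue" "{x. \<not> (x \<in> K \<longrightarrow> a \<bullet> x = 0)} \<subseteq> N"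
    by (auto simp: eventually_ae_filter)
  then have "negligible {x. \<not> (x \<in> K \<longrightarrow> a \<bullet> x = 0)}"
    by (meson negligible_iff_null_sets negligible_subset)
  moreover have "negligible {x. a \<bullet> x = 0}" using a by (intro negligible_hyperplane) auto
  ultimately have "negligible ({x. \<not> (x \<in> K \<longrightarrow> a \<bullet> x = 0)} \<union> {x. a \<bullet> x = 0})"
    by (rule negligible_Un)
  then have "negligible K" by (rule negligible_subset) auto
  with notneg show False ..
qed

text \<open>The contribution of one body, with the exponent \<open>1 / (n + q)\<close> moved inside
  the product over the bodies. The infinite case is the pointwise limit as q tends to infinity in
  either direction, where the exponent of the support function tends to -1 and that of the curvature
  function to 0.\<close>

definition affine_density :: "ereal \<Rightarrow> (real^'n) set \<Rightarrow> real^'n \<Rightarrow> real" where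
  "affine_density p K u = (case p of
     ereal q \<Rightarrow> (support_function K u powr (1 - q) * curvature_function K u) powr (1 / (real CARD('n) + q))
   | _ \<Rightarrow> 1 / support_function K u)"

lemma mixed_affine_surface_area_eq:
  fixes K :: "nat \<Rightarrow> (real^'n) set"
  shows "mixed_affine_surface_area p K =
    (LINT u|sphere_measure. (\<Prod>k=1..CARD('n). affine_density p (K k) u))"
  by (cases p)
    (simp_all add: mixed_affine_surface_area_def affine_density_def prod_powr_distrib prod_dividef)

lemma affine_density_pos:
  assumes "C2_plus_body K" "u \<in> sphere 0 1"
  shows "affine_density p K u > 0"
  using C2_plus_body.support_function_pos[OF assms] C2_plus_body.curvature_function_pos[OF assms]
  by (cases p) (auto simp: affine_density_def)

lemma continuous_on_affine_density:
  assumes "C2_plus_body K"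
  shows "continuous_on (sphere 0 1) (affine_density p K)"
proof -
  interpret C2_plus_body K by (rule assms)
  note [continuous_intros] = continuous_on_support_function continuous_on_curvature_function
  have pos: "support_function K u \<noteq> 0" "curvature_function K u \<noteq> 0" if "u \<in> sphere 0 1" for u
    using support_function_pos[OF that] curvature_function_pos[OF that] by auto
  show ?thesis
  proof (cases p)
    case (real q)
    have "continuous_on (sphere 0 1) (\<lambda>u. (support_function K u powr (1 - q) * curvature_function K u)
        powr (1 / (real CARD('a) + q)))"
      using pos by (intro continuous_intros) auto
    then show ?thesis by (simp add: affine_density_def[abs_def] real)
  qed (use pos in \<open>auto simp: affine_density_def[abs_def] intro!: continuous_intros\<close>)
qed

lemma dilation_affine_density:
  assumes K: "C2_plus_body K" and L: "C2_plus_body L" and "dilates K L"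
  shows "\<exists>d. \<forall>u\<in>sphere 0 1. affine_density p K u = d * affine_density p L u"
proof -
  obtain c where c: "c > 0" "K = (\<lambda>x. c *\<^sub>R x) ` L" using assms by (auto simp: dilates_def)
  note supp = dilation_support_function[OF K L c]
  obtain d where d: "\<forall>u\<in>sphere 0 1. curvature_function K u = d * curvature_function L u"
    using dilation_curvature_function[OF K L c] by blast
  show ?thesis
  proof (cases p)
    case (real q)
    define e where "e = 1 / (real CARD('a) + q)"
    have "affine_density p K u = (c powr (1 - q) * d) powr e * affine_density p L u"
      if u: "u \<in> sphere 0 1" for u
    proof -
      have "affine_density p K u =
          ((c * support_function L u) powr (1 - q) * (d * curvature_function L u)) powr e"
        by (simp only: affine_density_def real ereal.case e_def supp[OF u] bspec[OF d u])
      also have "\<dots> = (c powr (1 - q) * d) powr e *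
          (support_function L u powr (1 - q) * curvature_function L u) powr e"
        by (simp only: powr_mult mult_ac)
      finally show ?thesis by (simp only: affine_density_def real ereal.case e_def)
    qed
    then show ?thesis by blast
  next
    case PInf
    have "affine_density p K u = (1 / c) * affine_density p L u" if u: "u \<in> sphere 0 1" for u
      by (simp add: affine_density_def PInf supp[OF u])
    then show ?thesis by blast
  next
    case MInf
    have "affine_density p K u = (1 / c) * affine_density p L u" if u: "u \<in> sphere 0 1" for u
      by (simp add: affine_density_def MInf supp[OF u])
    then show ?thesis by blast
  qed
qed

lemma mixed_affine_surface_area_cong:
  fixes K L :: "nat \<Rightarrow> (real^'n) set"
  assumes "\<And>k. k \<in> {1..CARD('n)} \<Longrightarrow> K k = L k"
  shows "mixed_affine_surface_area p K = mixed_affine_surface_area p L"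
proof -
  have "(\<Prod>k=1..CARD('n). affine_density p (K k) u) = (\<Prod>k=1..CARD('n). affine_density p (L k) u)" for u
    using assms by (intro prod.cong) simp_all
  then show ?thesis by (simp only: mixed_affine_surface_area_eq)
qed

section \<open>Separating the last m factors of the integrand\<close>

lemma prod_replace_tail:
  fixes f :: "'b \<Rightarrow> 'c::comm_monoid_mult"
  assumes "m \<le> n"
  shows "(\<Prod>j=1..n. f (if j \<le> n - m then K j else L)) = (\<Prod>j=1..n - m. f (K j)) * f L ^ m"
proof -
  have "{1..n} = {1..n - m} \<union> {n - m + 1..n}" using assms by auto
  then have "(\<Prod>j=1..n. f (if j \<le> n - m then K j else L)) =
      (\<Prod>j=1..n - m. f (if j \<le> n - m then K j else L)) *
      (\<Prod>j=n - m + 1..n. f (if j \<le> n - m then K j else L))"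
    by (simp add: prod.union_disjoint)
  also have "(\<Prod>j=1..n - m. f (if j \<le> n - m then K j else L)) = (\<Prod>j=1..n - m. f (K j))"
    by (rule prod.cong) auto
  also have "(\<Prod>j=n - m + 1..n. f (if j \<le> n - m then K j else L)) = f L ^ m"
    using assms by simp
  finally show ?thesis .
qed

lemma prod_split_tail:
  fixes f :: "nat \<Rightarrow> 'c::comm_monoid_mult"
  assumes "m \<le> n"
  shows "(\<Prod>j=1..n. f j) = (\<Prod>j=1..n - m. f j) * (\<Prod>i<m. f (n - i))"
proof -
  have "{1..n} = {1..n - m} \<union> {n - m + 1..n}" using assms by auto
  then have "(\<Prod>j=1..n. f j) = (\<Prod>j=1..n - m. f j) * (\<Prod>j=n - m + 1..n. f j)"
    by (simp add: prod.union_disjoint)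
  also have "(\<Prod>j=n - m + 1..n. f j) = (\<Prod>i<m. f (n - i))"
    \<comment> \<open>The tail is counted downwards: i = 0 is the last body, i = m - 1 is body n - m
      + 1.\<close>
    by (rule prod.reindex_bij_witness[of _ "\<lambda>i. n - i" "\<lambda>j. n - j"]) (use assms in auto)
  finally show ?thesis .
qed

lemma mixed_affine_surface_area_replace_tail:
  fixes K :: "nat \<Rightarrow> (real^'n) set"
  assumes "m \<le> n" "n = CARD('n)"
  shows "mixed_affine_surface_area p (\<lambda>j. if j \<le> n - m then K j else L) =
    (LINT u|sphere_measure. (\<Prod>j=1..n - m. affine_density p (K j) u) * affine_density p L u ^ m)"
proof -
  have "(\<Prod>j=1..n. affine_density p (if j \<le> n - m then K j else L) u) =
      (\<Prod>j=1..n - m. affine_density p (K j) u) * affine_density p L u ^ m" for u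
    using prod_replace_tail[OF assms(1), where f = "\<lambda>K. affine_density p K u"] .
  then show ?thesis by (simp only: mixed_affine_surface_area_eq assms(2)[symmetric])
qed

section \<open>The inequality and the case of dilates\<close>

lemma mixed_affine_surface_area_power_le:
  fixes K :: "nat \<Rightarrow> (real^'n) set"
  assumes n: "n = CARD('n)" and K: "\<And>k. k \<in> {1..n} \<Longrightarrow> C2_plus_body (K k)"
    and m: "1 \<le> m" "m \<le> n"
  shows "mixed_affine_surface_area p K ^ m
    \<le> (\<Prod>i<m. mixed_affine_surface_area p (\<lambda>j. if j \<le> n - m then K j else K (n - i)))"
proof -
  define F where "F k u = affine_density p (K k) u" for k u
  have pos: "F k u > 0" if "k \<in> {1..n}" "u \<in> sphere 0 1" for k u
    unfolding F_def using affine_density_pos K that by blast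
  have cont: "continuous_on (sphere 0 1) (F k)" if "k \<in> {1..n}" for k
    unfolding F_def using continuous_on_affine_density K that by blast
  define g where "g u = (\<Prod>j=1..n - m. F j u)" for u
  have g: "continuous_on (sphere 0 1) g" unfolding g_def by (intro continuous_intros cont) auto
  have "mixed_affine_surface_area p K = (LINT u|sphere_measure. g u * (\<Prod>i<m. F (n - i) u))"
    using prod_split_tail[OF m(2), of "\<lambda>j. F j _"]
    by (simp add: mixed_affine_surface_area_eq n[symmetric] g_def F_def)
  moreover have "(LINT u|sphere_measure. g u * (\<Prod>i<m. F (n - i) u)) ^ card {..<m} \<le>
      (\<Prod>i<m. LINT u|sphere_measure. g u * F (n - i) u ^ card {..<m})"
  proof (rule weighted_Holder)
    show "integrable sphere_measure (\<lambda>u. g u * (\<Prod>i<m. F (n - i) u))"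
      using m by (intro integrable_sphere_measure continuous_intros cont g) auto
    show "integrable sphere_measure (\<lambda>u. g u * F (n - i) u ^ card {..<m})" if "i \<in> {..<m}" for i
      using m that by (intro integrable_sphere_measure continuous_intros cont g) auto
    show "g u \<ge> 0" if "u \<in> space sphere_measure" for u
      unfolding g_def using that by (intro prod_nonneg less_imp_le pos) auto
    show "F (n - i) u \<ge> 0" if "i \<in> {..<m}" "u \<in> space sphere_measure" for i u
      using that m by (intro less_imp_le pos) auto
  qed (use m in \<open>auto simp: lessThan_empty_iff\<close>)
  ultimately show ?thesis
    by (simp add: mixed_affine_surface_area_replace_tail[OF m(2) n] g_def F_def)
qed

text \<open>On the sphere the density of body n - i is a constant \<open>d i\<close> times that of
  body n. With \<open>A\<close> the integral for m copies of body n, the mixed area is the product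
  of the \<open>d i\<close> times \<open>A\<close>, and the i-th factor on the right is
  \<open>d i ^ m * A\<close>; both sides equal the m-th power of that product times
  \<open>A ^ m\<close>.\<close>

lemma mixed_affine_surface_area_power_eq:
  fixes K :: "nat \<Rightarrow> (real^'n) set"
  assumes n: "n = CARD('n)" and K: "\<And>k. k \<in> {1..n} \<Longrightarrow> C2_plus_body (K k)"
    and m: "1 \<le> m" "m \<le> n" and dil: "\<And>k. k \<in> {n-m+1..n} \<Longrightarrow> dilates (K k) (K n)"
  shows "mixed_affine_surface_area p K ^ m
    = (\<Prod>i<m. mixed_affine_surface_area p (\<lambda>j. if j \<le> n - m then K j else K (n - i)))"
proof -
  define F where "F k u = affine_density p (K k) u" for k u
  define g where "g u = (\<Prod>j=1..n - m. F j u)" for u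
  have "\<exists>d. \<forall>u\<in>sphere 0 1. F (n - i) u = d * F n u" if "i < m" for i
    unfolding F_def using that m by (intro dilation_affine_density K dil) auto
  then obtain d where d: "\<And>i u. i < m \<Longrightarrow> u \<in> sphere 0 1 \<Longrightarrow> F (n - i) u = d i * F n u"
    by metis
  define A where "A = (LINT u|sphere_measure. g u * F n u ^ m)"
  have "mixed_affine_surface_area p K = (LINT u|sphere_measure. g u * (\<Prod>i<m. F (n - i) u))"
    using prod_split_tail[OF m(2), of "\<lambda>j. F j _"]
    by (simp add: mixed_affine_surface_area_eq n[symmetric] g_def F_def)
  also have "\<dots> = (LINT u|sphere_measure. (\<Prod>i<m. d i) * (g u * F n u ^ m))"
    by (intro Bochner_Integration.integral_cong) (simp_all add: d prod.distrib)
  finally have "mixed_affine_surface_area p K = (\<Prod>i<m. d i) * A" by (simp add: A_def)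
  moreover have "mixed_affine_surface_area p (\<lambda>j. if j \<le> n - m then K j else K (n - i)) = d i ^ m * A"
    if "i < m" for i
  proof -
    have "mixed_affine_surface_area p (\<lambda>j. if j \<le> n - m then K j else K (n - i)) =
        (LINT u|sphere_measure. g u * F (n - i) u ^ m)"
      by (simp add: mixed_affine_surface_area_replace_tail[OF m(2) n] g_def F_def)
    also have "\<dots> = (LINT u|sphere_measure. d i ^ m * (g u * F n u ^ m))"
      using that by (intro Bochner_Integration.integral_cong) (simp_all add: d power_mult_distrib)
    finally show ?thesis by (simp add: A_def)
  qed
  ultimately show ?thesis by (simp add: prod.distrib prod_power_distrib power_mult_distrib)
qed

theorem proposition2p1:
  fixes K :: "nat \<Rightarrow> (real^'n) set" and p :: ereal and n m :: nat
  assumes n: "n = CARD('n)"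
    and K: "\<And>k. k \<in> {1..n} \<Longrightarrow> convex_body (K k) \<and> C2_plus (K k) \<and> centroid (K k) = 0"
    and p: "p \<noteq> - ereal (real n)"
    and m: "1 \<le> m" "m \<le> n"
  shows
    "mixed_affine_surface_area p K ^ m
        \<le> (\<Prod>i<m. mixed_affine_surface_area p (\<lambda>j. if j \<le> n - m then K j else K (n - i)))
     \<and> ((\<forall>k\<in>{n-m+1..n}. \<forall>l\<in>{n-m+1..n}. dilates (K k) (K l)) \<longrightarrow>
        mixed_affine_surface_area p K ^ m
          = (\<Prod>i<m. mixed_affine_surface_area p (\<lambda>j. if j \<le> n - m then K j else K (n - i))))
     \<and> (m = 1 \<longrightarrow>
        mixed_affine_surface_area p K ^ m
          = (\<Prod>i<m. mixed_affine_surface_area p (\<lambda>j. if j \<le> n - m then K j else K (n - i))))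
     \<and> mixed_affine_surface_area p K ^ n \<le> (\<Prod>i=1..n. affine_surface_area p (K i))"
proof (intro conjI impI)
  have body: "C2_plus_body (K k)" if "k \<in> {1..n}" for k
    using K[OF that] by (simp add: C2_plus_body_def centroid_in_interior)
  show "mixed_affine_surface_area p K ^ m
      \<le> (\<Prod>i<m. mixed_affine_surface_area p (\<lambda>j. if j \<le> n - m then K j else K (n - i)))"
    by (rule mixed_affine_surface_area_power_le[OF n body m])
  show "mixed_affine_surface_area p K ^ m
      = (\<Prod>i<m. mixed_affine_surface_area p (\<lambda>j. if j \<le> n - m then K j else K (n - i)))"
    if "\<forall>k\<in>{n-m+1..n}. \<forall>l\<in>{n-m+1..n}. dilates (K k) (K l)"
    using that m by (intro mixed_affine_surface_area_power_eq[OF n body m]) auto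
  show "mixed_affine_surface_area p K ^ m
      = (\<Prod>i<m. mixed_affine_surface_area p (\<lambda>j. if j \<le> n - m then K j else K (n - i)))"
    if "m = 1"
  proof -
    \<comment> \<open>For m = 1 the only index beyond n - 1 is n, so replacing the tail by body n
      changes nothing. The form \<open>n - 0\<close> matches the single factor i = 0 of the
      product.\<close>
    have eq: "mixed_affine_surface_area p (\<lambda>j. if j \<le> n - m then K j else K (n - 0)) = mixed_affine_surface_area p K"
    proof (rule mixed_affine_surface_area_cong)
      fix k assume "k \<in> {1..CARD('n)}"
      then have "k = n" if "\<not> k \<le> n - m" using that \<open>m = 1\<close> n by simp
      then show "(if k \<le> n - m then K k else K (n - 0)) = K k" by auto
    qed
    have "{..<m} = {0}" using that by auto
    then have "(\<Prod>i<m. mixed_affine_surface_area p (\<lambda>j. if j \<le> n - m then K j else K (n - i)))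
        = mixed_affine_surface_area p (\<lambda>j. if j \<le> n - m then K j else K (n - 0))"
      by (simp only: prod.insert prod.empty finite.emptyI empty_iff not_False_eq_True mult_1_right)
    then show ?thesis using that eq by (metis power_one_right)
  qed
  \<comment> \<open>With m = n no body of the head remains, since j \<le> n - n fails for all j from
    1 on; each factor is then the affine surface area of a single body.\<close>
  have "mixed_affine_surface_area p K ^ n
      \<le> (\<Prod>i<n. mixed_affine_surface_area p (\<lambda>j. if j \<le> n - n then K j else K (n - i)))"
    using m by (intro mixed_affine_surface_area_power_le[OF n body]) auto
  also have "\<dots> = (\<Prod>i<n. affine_surface_area p (K (n - i)))"
    unfolding affine_surface_area_def
    by (intro prod.cong mixed_affine_surface_area_cong) auto
  \<comment> \<open>Reversal of the index, obtained from \<open>prod_split_tail\<close> with an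
    empty head.\<close>
  also have "\<dots> = (\<Prod>i=1..n. affine_surface_area p (K i))"
    using prod_split_tail[of n n "\<lambda>i. affine_surface_area p (K i)"] by simp
  finally show "mixed_affine_surface_area p K ^ n \<le> (\<Prod>i=1..n. affine_surface_area p (K i))" .
qed

end
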